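(* Let $1\le s_1<s_2<\dots<s_k$ be fixed integers, $k\ge1$. For each integer $n>s_k$ such that the circulant graph $C_{2n}(s_1,\dots,s_k,n)$ is connected (i.e. $\gcd(s_1,\dots,s_k,n)=1$), let $\tau(n)$ be its number of spanning trees. Let $p$ be the number of odd elements in the sequence $s_1,\dots,s_k$, let $q$ be the square-free part of $2p$ and let $r$ be the square-free part of $2p+1$. Then there exists an integer sequence $a(n)$ such that for all such $n$: $1^0$. $\tau(n)=r\,n\,a(n)^2$ if $n$ is odd; $2^0$. $\tau(n)=q\,n\,a(n)^2$ if $n$ is even.
   Context: $C_{2n}(s_1,\dots,s_k,n)$ is the graph with vertices $0,1,\dots,2n-1$ in which each vertex $i$ is adjacent to the vertices $i\pm s_1,\dots,i\pm s_k$ and $i+n\pmod{2n}$ (a single edge joins $i$ and $i+n$, so every vertex has degree $2k+1$). Any positive integer $m$ can be uniquely written as $m=c\,b^2$ with $c,b$ positive integers and $c$ square-free; $c$ is called the square-free part of $m$. (The number $q$ is used only when $n$ is even; in that case connectedness forces $p\ge1$, so $q$ is defined.) *)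

theory Defs
  imports
    "HOL-Computational_Algebra.Squarefree"
    "HOL-Number_Theory.Cong"
begin

text \<open>
  A finite simple graph is given by its vertex set \<open>V\<close> and its set \<open>E\<close> of edges, each edge being
  a two-element subset \<open>{u, v}\<close> of \<open>V\<close>.
\<close>

definition graph_connected :: "'a set \<Rightarrow> 'a set set \<Rightarrow> bool" where
  "graph_connected V E \<longleftrightarrow>
     V \<noteq> {} \<and> (\<forall>u\<in>V. \<forall>v\<in>V. (u, v) \<in> {(x, y). {x, y} \<in> E}\<^sup>*)"

text \<open>
  A cycle is the list of its vertices; the edge closing it joins the last vertex to the first.
  Since cycles of a simple graph have at least three vertices, going back and forth along one
  edge is not a cycle.
\<close>

definition graph_cycle :: "'a set set \<Rightarrow> 'a list \<Rightarrow> bool" where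
  "graph_cycle E xs \<longleftrightarrow>
     length xs \<ge> 3 \<and> distinct xs \<and>
     (\<forall>i<length xs. {xs ! i, xs ! (Suc i mod length xs)} \<in> E)"

definition graph_tree :: "'a set \<Rightarrow> 'a set set \<Rightarrow> bool" where
  "graph_tree V E \<longleftrightarrow> graph_connected V E \<and> (\<nexists>xs. graph_cycle E xs)"

text \<open>
  A spanning tree has all of \<open>V\<close> as its vertex set and is therefore determined by its edges.
\<close>

definition spanning_trees :: "'a set \<Rightarrow> 'a set set \<Rightarrow> 'a set set set" where
  "spanning_trees V E = {T. T \<subseteq> E \<and> graph_tree V T}"

definition num_spanning_trees :: "'a set \<Rightarrow> 'a set set \<Rightarrow> nat" where
  "num_spanning_trees V E = card (spanning_trees V E)"

text \<open>
  Edges of the circulant graph on \<open>{..<m}\<close> with set of jumps \<open>S\<close>. If \<open>0 < s < m\<close> for all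
  \<open>s \<in> S\<close>, there are no loops. A jump \<open>s\<close> with \<open>2 * s = m\<close> contributes a single edge at each
  vertex, because \<open>i + s\<close> and \<open>i - s\<close> are then congruent modulo \<open>m\<close>.
\<close>

definition circulant_edges :: "nat \<Rightarrow> nat set \<Rightarrow> nat set set" where
  "circulant_edges m S =
     {{i, j} | i j. i < m \<and> j < m \<and>
        (\<exists>s\<in>S. [int j = int i + int s] (mod int m) \<or> [int j = int i - int s] (mod int m))}"

end

theory Submission
  imports Defs "Jordan_Normal_Form.Determinant" Complex_Main
begin

text \<open>
  Everything follows from a formula for an arbitrary circulant graph with an even number \<open>2 n\<close> of
  vertices: its number of spanning trees is \<open>n * o * g\<^sup>2\<close> for some integer \<open>g\<close>, where \<open>o\<close> is the
  number of odd residues modulo \<open>2 n\<close> among its jumps. For the jumps \<open>s\<^sub>1, \<dots>, s\<^sub>k, n\<close> the number \<open>o\<close>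
  is \<open>2 p\<close> or \<open>2 p + 1\<close> according to the parity of \<open>n\<close>, and its square part can be moved into \<open>g\<close>.

  The Laplacian of the graph is a circulant matrix, with eigenvalues \<open>\<lambda>\<^sub>0 = 0, \<lambda>\<^sub>1, \<dots>, \<lambda>\<^sub>m\<^sub>-\<^sub>1\<close> for
  \<open>m = 2 n\<close>. The matrix tree theorem (\<open>matrix_tree\<close>) and Fourier analysis
  (\<open>det_reduced_circulant\<close>) give \<open>2 n \<tau> = \<lambda>\<^sub>1 \<cdots> \<lambda>\<^sub>m\<^sub>-\<^sub>1\<close>. Since the graph is
  undirected, \<open>\<lambda>\<^sub>a = \<lambda>\<^sub>m\<^sub>-\<^sub>a\<close>, so that \<open>2 n \<tau> = \<lambda>\<^sub>n A\<^sup>2\<close> with \<open>A = \<lambda>\<^sub>1 \<cdots> \<lambda>\<^sub>n\<^sub>-\<^sub>1\<close>; the unpaired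
  eigenvalue \<open>\<lambda>\<^sub>n\<close> belongs to the alternating vector and equals \<open>2 o\<close>.

  It remains to see that \<open>A\<close> is an integer and that \<open>n\<close> divides it. Both come from one
  interpretation of \<open>A\<close>: it is the determinant of the Laplacian acting on odd functions on the
  residues modulo \<open>2 n\<close> (\<open>det_odd_part\<close>). This space has the integral basis \<open>e\<^sub>j - e\<^sub>-\<^sub>j\<close> with
  \<open>0 < j < n\<close>, which makes \<open>A\<close> an integer. The function \<open>x \<mapsto> x\<close> is odd and, modulo \<open>n\<close>,
  harmonic, because the neighbours \<open>x + d\<close> and \<open>x - d\<close> of \<open>x\<close> balance. Hence \<open>(1, \<dots>, n - 1)\<close> is
  a left kernel vector modulo \<open>n\<close>, and as its first entry is \<open>1\<close> it shows that \<open>n\<close> divides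
  \<open>A\<close> (\<open>dvd_det_odd_part\<close>). So \<open>A = n g\<close> and \<open>2 n \<tau> = 2 o n\<^sup>2 g\<^sup>2\<close>.
\<close>

section \<open>Spanning trees as parent maps\<close>

text \<open>
  Extending a simple path by an edge either gives a simple path or returns to a vertex already
  visited, at which the path is then cut off.
\<close>

lemma simple_path_if_rtrancl:
  assumes "(u, v) \<in> {(x, y). {x, y} \<in> T}\<^sup>*"
  shows "\<exists>xs. xs \<noteq> [] \<and> distinct xs \<and> hd xs = u \<and> last xs = v \<and>
           (\<forall>i. Suc i < length xs \<longrightarrow> {xs ! i, xs ! Suc i} \<in> T)"
  using assms
proof (induction rule: rtrancl_induct)
  case base
  show ?case by (rule exI[of _ "[u]"]) auto
next
  case (step y z)
  then obtain xs where xs: "xs \<noteq> []" "distinct xs" "hd xs = u" "last xs = y"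
    "\<And>i. Suc i < length xs \<Longrightarrow> {xs ! i, xs ! Suc i} \<in> T" by blast
  show ?case
  proof (cases "z \<in> set xs")
    case True
    then obtain k where k: "k < length xs" "xs ! k = z" by (auto simp: in_set_conv_nth)
    have "last (take (Suc k) xs) = z"
      using k by (simp add: take_Suc_conv_app_nth)
    then show ?thesis
      using xs k by (intro exI[of _ "take (Suc k) xs"]) (auto simp: hd_take)
  next
    case False
    have "{(xs @ [z]) ! i, (xs @ [z]) ! Suc i} \<in> T" if "Suc i < length (xs @ [z])" for i
    proof (cases "Suc i < length xs")
      case True
      then show ?thesis using xs(5)[of i] by (simp add: nth_append)
    next
      case False
      then have "i = length xs - 1" "Suc i = length xs" using that by auto
      then have "(xs @ [z]) ! i = y" "(xs @ [z]) ! Suc i = z"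
        using xs(1,4) by (auto simp: nth_append last_conv_nth)
      then show ?thesis using step.hyps(2) by simp
    qed
    then show ?thesis
      using xs False by (intro exI[of _ "xs @ [z]"]) auto
  qed
qed

text \<open>
  The new edge closes a simple path from \<open>u\<close> to \<open>v\<close>. That path has at least three vertices because
  \<open>{u, v}\<close> is not among its edges.
\<close>

lemma cycle_if_joined:
  assumes conn: "(u, v) \<in> {(x, y). {x, y} \<in> T}\<^sup>*"
    and "u \<noteq> v" and new: "{u, v} \<notin> T"
  shows "\<exists>xs. graph_cycle (insert {u, v} T) xs"
proof -
  obtain xs where xs: "xs \<noteq> []" "distinct xs" "hd xs = u" "last xs = v"
    "\<And>i. Suc i < length xs \<Longrightarrow> {xs ! i, xs ! Suc i} \<in> T"
    using simple_path_if_rtrancl[OF conn] by blast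
  have ends: "xs ! 0 = u" "xs ! (length xs - 1) = v"
    using xs(1,3,4) by (auto simp: hd_conv_nth last_conv_nth)
  have "length xs \<noteq> 1" using ends \<open>u \<noteq> v\<close> by auto
  moreover have "length xs \<noteq> 2" using ends new xs(5)[of 0] by auto
  moreover have "length xs \<noteq> 0" using xs(1) by simp
  ultimately have len: "length xs \<ge> 3" by linarith
  have "{xs ! i, xs ! (Suc i mod length xs)} \<in> insert {u, v} T" if "i < length xs" for i
  proof (cases "Suc i < length xs")
    case True
    then show ?thesis using xs(5) by simp
  next
    case False
    then have "i = length xs - 1" "Suc i mod length xs = 0"
      using that len by (auto simp: not_less le_Suc_eq)
    then show ?thesis using ends by (auto simp: insert_commute)
  qed
  then show ?thesis using len xs(2) unfolding graph_cycle_def by blast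
qed

text \<open>
  A spanning tree rooted at \<open>r\<close> is encoded by the map sending every other vertex to the next one on
  its way to the root. Fixing the points outside \<open>V - {r}\<close> makes the encoding unique; it is also the
  convention under which the multilinear expansion of a determinant sums over functions.
\<close>

definition parent_maps :: "'a set \<Rightarrow> 'a \<Rightarrow> 'a set set \<Rightarrow> ('a \<Rightarrow> 'a) set" where
  "parent_maps V r E =
     {f. (\<forall>i\<in>V - {r}. {i, f i} \<in> E \<and> (\<exists>m. (f ^^ m) i = r)) \<and> (\<forall>i. i \<notin> V - {r} \<longrightarrow> f i = i)}"

definition parent_edges :: "'a set \<Rightarrow> 'a \<Rightarrow> ('a \<Rightarrow> 'a) \<Rightarrow> 'a set set" where
  "parent_edges V r f = (\<lambda>i. {i, f i}) ` (V - {r})"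

definition height :: "('a \<Rightarrow> 'a) \<Rightarrow> 'a \<Rightarrow> 'a \<Rightarrow> nat" where
  "height f r i = (LEAST m. (f ^^ m) i = r)"

lemma height_parent:
  assumes "(f ^^ m) i = r" "i \<noteq> r"
  shows "height f r i = Suc (height f r (f i))"
  using Least_Suc[of "\<lambda>m. (f ^^ m) i = r" m] assms
  by (auto simp: height_def funpow_swap1 simp del: funpow.simps(2) simp: funpow_Suc_right)

text \<open>
  A vertex of maximal height on a cycle has only one possible neighbour on it, its parent, but a
  cycle provides two.
\<close>

lemma parent_edges_acyclic:
  assumes f: "f \<in> parent_maps V r E"
  shows "\<not> graph_cycle (parent_edges V r f) xs"
proof
  assume "graph_cycle (parent_edges V r f) xs"
  then have len: "length xs \<ge> 3" and dist: "distinct xs"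
    and edge: "\<And>i. i < length xs \<Longrightarrow> {xs ! i, xs ! (Suc i mod length xs)} \<in> parent_edges V r f"
    unfolding graph_cycle_def by auto
  let ?n = "length xs"
  let ?h = "height f r"
  let ?H = "(\<lambda>j. ?h (xs ! j)) ` {..<?n}"
  have H: "finite ?H" "?H \<noteq> {}" using len by (auto simp: lessThan_empty_iff)
  obtain k where k: "k < ?n" "Max ?H = ?h (xs ! k)" using Max_in[OF H] by auto
  then have max: "?h (xs ! j) \<le> ?h (xs ! k)" if "j < ?n" for j
    using Max_ge[OF H(1), of "?h (xs ! j)"] that by auto
  have parent: "y = f x" if "{x, y} \<in> parent_edges V r f" "?h y \<le> ?h x" for x y
  proof -
    obtain i where i: "i \<in> V - {r}" "{x, y} = {i, f i}"
      using \<open>{x, y} \<in> _\<close> unfolding parent_edges_def by blast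
    obtain m where "(f ^^ m) i = r" using f i(1) unfolding parent_maps_def by blast
    then have "?h i = Suc (?h (f i))" using i(1) by (intro height_parent) auto
    then show ?thesis using i(2) \<open>?h y \<le> ?h x\<close> by (auto simp: doubleton_eq_iff)
  qed
  define a where "a = Suc k mod ?n"
  define b where "b = (if k = 0 then ?n - 1 else k - 1)"
  have ab: "a < ?n" "b < ?n" "a \<noteq> b" and b: "Suc b mod ?n = k"
    using k(1) len by (auto simp: a_def b_def mod_Suc)
  have "{xs ! k, xs ! a} \<in> parent_edges V r f" using edge[OF k(1)] unfolding a_def .
  moreover have "{xs ! k, xs ! b} \<in> parent_edges V r f"
    using edge[OF ab(2)] unfolding b by (simp add: insert_commute)
  ultimately have "xs ! a = xs ! b" using parent[OF _ max] ab(1,2) by metis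
  then show False using dist ab by (simp add: nth_eq_iff_index_eq)
qed

lemma parent_edges_connected:
  assumes "r \<in> V" and E: "\<And>e. e \<in> E \<Longrightarrow> e \<subseteq> V" and f: "f \<in> parent_maps V r E"
  shows "graph_connected V (parent_edges V r f)"
proof -
  let ?R = "{(x, y). {x, y} \<in> parent_edges V r f}"
  have to_root: "i \<in> V \<Longrightarrow> (f ^^ m) i = r \<Longrightarrow> (i, r) \<in> ?R\<^sup>*" for i m
  proof (induction m arbitrary: i)
    case (Suc m)
    show ?case
    proof (cases "i = r")
      case False
      then have i: "i \<in> V - {r}" using Suc.prems(1) by blast
      then have "{i, f i} \<in> E" using f unfolding parent_maps_def by blast
      then have "f i \<in> V" using E by blast
      moreover have "(f ^^ m) (f i) = r" using Suc.prems(2) by (simp add: funpow_swap1)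
      ultimately have "(f i, r) \<in> ?R\<^sup>*" using Suc.IH by blast
      moreover have "(i, f i) \<in> ?R" using i unfolding parent_edges_def by blast
      ultimately show ?thesis by (rule converse_rtrancl_into_rtrancl[rotated])
    qed simp
  qed simp
  have root: "(i, r) \<in> ?R\<^sup>*" if "i \<in> V" for i
    using to_root[OF that] f that unfolding parent_maps_def by (cases "i = r") auto
  have "sym (?R\<^sup>*)" by (rule sym_rtrancl) (auto simp: sym_def insert_commute)
  then have "(u, v) \<in> ?R\<^sup>*" if "u \<in> V" "v \<in> V" for u v
    using root that by (meson rtrancl_trans symE)
  then show ?thesis using \<open>r \<in> V\<close> unfolding graph_connected_def by auto
qed

text \<open>
  If \<open>f\<close> and \<open>g\<close> have the same edges but differ at \<open>i\<close>, then the edge \<open>{i, g i}\<close> must be the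
  \<open>f\<close>-edge of \<open>g i\<close>, so \<open>f\<close> and \<open>g\<close> differ at \<open>g i\<close> as well. Following \<open>g\<close>, the difference
  propagates up to the root, where both maps agree.
\<close>

lemma parent_edges_inj:
  shows "inj_on (parent_edges V r) (parent_maps V r E)"
proof (rule inj_onI, rule ccontr)
  fix f g
  assume f: "f \<in> parent_maps V r E" and g: "g \<in> parent_maps V r E"
    and eq: "parent_edges V r f = parent_edges V r g" and "f \<noteq> g"
  define B where "B = {i \<in> V - {r}. f i \<noteq> g i}"
  have step: "g i \<in> B \<and> f (g i) = i" if "i \<in> B" for i
  proof -
    have i: "i \<in> V - {r}" "f i \<noteq> g i" using that unfolding B_def by auto
    then have "{i, g i} \<in> parent_edges V r f" using eq unfolding parent_edges_def by auto
    then obtain j where "j \<in> V - {r}" "{i, g i} = {j, f j}" unfolding parent_edges_def by auto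
    then have j: "g i \<in> V - {r}" "f (g i) = i"
      using i(2) by (auto simp: doubleton_eq_iff)
    have "g (g i) \<noteq> i"
    proof
      assume gg: "g (g i) = i"
      have "(g ^^ m) i \<in> {i, g i}" for m by (induction m) (use gg in auto)
      moreover obtain m where "(g ^^ m) i = r" using g i(1) unfolding parent_maps_def by blast
      ultimately have "r \<in> {i, g i}" by metis
      then show False using i j by auto
    qed
    then show ?thesis using j unfolding B_def by auto
  qed
  have stays: "(g ^^ m) i \<in> B" if "i \<in> B" for i m
    by (induction m) (use that step in auto)
  obtain i where "f i \<noteq> g i" using \<open>f \<noteq> g\<close> by blast
  moreover have "f i = i" "g i = i" if "i \<notin> V - {r}"
    using f g that unfolding parent_maps_def by blast+
  ultimately have "i \<in> B" unfolding B_def by fastforce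
  moreover from this obtain m where "(g ^^ m) i = r"
    using g unfolding parent_maps_def B_def by blast
  ultimately have "r \<in> B" using stays by metis
  then show False unfolding B_def by blast
qed

text \<open>
  Each vertex takes as its parent a neighbour in \<open>T\<close> that is closer to the root. The edges obtained
  in this way already connect \<open>V\<close>, so any further edge of \<open>T\<close> would close a cycle.
\<close>

lemma parent_map_of_tree:
  assumes "r \<in> V" and TE: "T \<subseteq> E"
    and E: "\<And>e. e \<in> E \<Longrightarrow> e \<subseteq> V \<and> card e = 2"
    and T: "graph_tree V T"
  shows "\<exists>f\<in>parent_maps V r E. parent_edges V r f = T"
proof -
  let ?R = "{(x, y). {x, y} \<in> T}"
  define d where "d i = (LEAST m. (i, r) \<in> ?R ^^ m)" for i
  have closer: "\<exists>j. {i, j} \<in> T \<and> d j < d i" if i: "i \<in> V - {r}" for i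
  proof -
    have "(i, r) \<in> ?R\<^sup>*"
      using T i \<open>r \<in> V\<close> unfolding graph_tree_def graph_connected_def by blast
    then obtain m where "(i, r) \<in> ?R ^^ m" using rtrancl_imp_relpow by blast
    then have di: "(i, r) \<in> ?R ^^ d i" unfolding d_def by (rule LeastI)
    show ?thesis
    proof (cases "d i")
      case 0
      then show ?thesis using di i by simp
    next
      case (Suc l)
      then obtain j where "(i, j) \<in> ?R" "(j, r) \<in> ?R ^^ l"
        using di relpow_Suc_D2 by (metis (no_types, lifting))
      moreover from this have "d j \<le> l" unfolding d_def by (intro Least_le)
      ultimately show ?thesis using Suc by auto
    qed
  qed
  then obtain g where g: "\<And>i. i \<in> V - {r} \<Longrightarrow> {i, g i} \<in> T \<and> d (g i) < d i" by metis
  define f where "f i = (if i \<in> V - {r} then g i else i)" for i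
  have f: "{i, f i} \<in> T" "d (f i) < d i" if "i \<in> V - {r}" for i
    using g[OF that] that unfolding f_def by auto
  have reach: "i \<in> V \<Longrightarrow> \<exists>m. (f ^^ m) i = r" for i
  proof (induction "d i" arbitrary: i rule: less_induct)
    case less
    show ?case
    proof (cases "i = r")
      case True
      then show ?thesis by (intro exI[of _ 0]) simp
    next
      case False
      then have i: "i \<in> V - {r}" using less.prems by blast
      then have "f i \<in> V" using f(1) TE E by blast
      then obtain m where "(f ^^ m) (f i) = r" using less.hyps f(2)[OF i] by blast
      then have "(f ^^ Suc m) i = r" by (simp add: funpow_swap1)
      then show ?thesis by blast
    qed
  qed
  have f_in: "f \<in> parent_maps V r E"
    unfolding parent_maps_def using f(1) TE reach by (auto simp: f_def)
  have sub: "parent_edges V r f \<subseteq> T" unfolding parent_edges_def using f(1) by blast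
  have "e \<in> parent_edges V r f" if e: "e \<in> T" for e
  proof (rule ccontr)
    assume new: "e \<notin> parent_edges V r f"
    obtain u v where uv: "e = {u, v}" "u \<noteq> v" "u \<in> V" "v \<in> V"
    proof -
      have "e \<subseteq> V" "card e = 2" using E e TE by blast+
      then show ?thesis using that by (auto simp: card_2_iff)
    qed
    have "(u, v) \<in> {(x, y). {x, y} \<in> parent_edges V r f}\<^sup>*"
      using parent_edges_connected[OF \<open>r \<in> V\<close> _ f_in] E uv
      unfolding graph_connected_def by blast
    then obtain xs where "graph_cycle (insert {u, v} (parent_edges V r f)) xs"
      using cycle_if_joined uv(2) new unfolding uv(1) by metis
    moreover have "insert {u, v} (parent_edges V r f) \<subseteq> T" using sub e uv(1) by simp
    ultimately have "graph_cycle T xs" unfolding graph_cycle_def by (meson subsetD)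
    then show False using T unfolding graph_tree_def by blast
  qed
  then show ?thesis using f_in sub by blast
qed

lemma spanning_trees_bij_parent_maps:
  assumes "r \<in> V" and E: "\<And>e. e \<in> E \<Longrightarrow> e \<subseteq> V \<and> card e = 2"
  shows "bij_betw (parent_edges V r) (parent_maps V r E) (spanning_trees V E)"
  unfolding bij_betw_def
proof
  show "inj_on (parent_edges V r) (parent_maps V r E)" by (rule parent_edges_inj)
  have "parent_edges V r f \<in> spanning_trees V E" if f: "f \<in> parent_maps V r E" for f
  proof -
    have "parent_edges V r f \<subseteq> E"
      using f unfolding parent_edges_def parent_maps_def by blast
    then show ?thesis
      using parent_edges_connected[OF \<open>r \<in> V\<close> _ f] parent_edges_acyclic[OF f] E
      unfolding spanning_trees_def graph_tree_def by blast
  qed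
  moreover have "T \<in> parent_edges V r ` parent_maps V r E" if "T \<in> spanning_trees V E" for T
    using parent_map_of_tree[OF \<open>r \<in> V\<close> _ E, of T] that unfolding spanning_trees_def by blast
  ultimately show "parent_edges V r ` parent_maps V r E = spanning_trees V E" by blast
qed

section \<open>The matrix tree theorem\<close>

definition reduced_laplacian :: "nat \<Rightarrow> nat set set \<Rightarrow> int mat" where
  "reduced_laplacian N E = mat N N (\<lambda>(i, j).
     (if i = j then int (card {v \<in> {0..<Suc N}. {i, v} \<in> E}) else 0) - of_bool ({i, j} \<in> E))"

text \<open>
  Vertex \<open>N\<close> is the root and has neither row nor column, so row \<open>i\<close> is \<open>e\<^sub>i - e\<^sub>f\<^sub>i\<close>, or just \<open>e\<^sub>i\<close> if
  \<open>f i\<close> is the root.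
\<close>

definition parent_mat :: "nat \<Rightarrow> (nat \<Rightarrow> nat) \<Rightarrow> int mat" where
  "parent_mat N f = mat N N (\<lambda>(i, j). of_bool (j = i) - of_bool (j = f i))"

text \<open>
  In the Leibniz formula a permutation contributes only if it moves points along \<open>f\<close>. Once it moves a
  point it moves the whole \<open>f\<close>-orbit, including the root, which is impossible. Only the identity
  remains.
\<close>

lemma det_parent_mat_rooted:
  assumes reach: "\<And>i. i < N \<Longrightarrow> \<exists>m. (f ^^ m) i = N" and moves: "\<And>i. i < N \<Longrightarrow> f i \<noteq> i"
  shows "det (parent_mat N f) = 1"
proof -
  have carr: "parent_mat N f \<in> carrier_mat N N" by (simp add: parent_mat_def)
  let ?t = "\<lambda>p. signof p * (\<Prod>i = 0..<N. parent_mat N f $$ (i, p i))"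
  have zero: "?t p = 0" if p: "p permutes {0..<N}" and "p \<noteq> id" for p
  proof (rule ccontr)
    assume "?t p \<noteq> 0"
    then have entries: "parent_mat N f $$ (i, p i) \<noteq> 0" if "i < N" for i using that by simp
    have along: "p x = f x" if "p x \<noteq> x" for x
    proof -
      have x: "x < N" using permutes_not_in[OF p, of x] \<open>p x \<noteq> x\<close> by auto
      then have "p x < N" using permutes_in_image[OF p, of x] by simp
      then show ?thesis
        using entries[OF x] x \<open>p x \<noteq> x\<close> by (auto simp: parent_mat_def split: if_splits)
    qed
    obtain i where i: "p i \<noteq> i" using \<open>p \<noteq> id\<close> by fastforce
    have orbit: "(f ^^ m) i = (p ^^ m) i \<and> p ((p ^^ m) i) \<noteq> (p ^^ m) i" for m
    proof (induction m)
      case (Suc m)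
      then show ?case using along permutes_inj[OF p] by (auto dest: injD)
    qed (use i in simp)
    have "i < N" using permutes_not_in[OF p, of i] i by auto
    then obtain m where "(f ^^ m) i = N" using reach by blast
    then have "p N \<noteq> N" using orbit[of m] by auto
    then show False using permutes_not_in[OF p, of N] by simp
  qed
  have "det (parent_mat N f) = sum ?t {p. p permutes {0..<N}}" by (rule det_def'[OF carr])
  also have "\<dots> = sum ?t {id}"
    using zero by (intro sum.mono_neutral_right) (auto simp: permutes_id finite_permutations)
  also have "\<dots> = 1" by (auto simp: parent_mat_def moves[THEN not_sym] intro!: prod.neutral)
  finally show ?thesis .
qed

text \<open>
  The set of vertices that never reach the root is closed under \<open>f\<close> and under preimages, so its
  indicator vector lies in the kernel.
\<close>

lemma det_parent_mat_unrooted: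
  assumes range: "\<And>i. i < N \<Longrightarrow> f i \<le> N" and "i < N" and lost: "\<And>m. (f ^^ m) i \<noteq> N"
  shows "det (parent_mat N f) = 0"
proof -
  let ?B = "\<lambda>j. \<forall>m. (f ^^ m) j \<noteq> N"
  define v :: "int vec" where "v = vec N (\<lambda>j. of_bool (?B j))"
  have carr: "parent_mat N f \<in> carrier_mat N N" by (simp add: parent_mat_def)
  have inv: "?B (f j) = ?B j" if "j < N" for j
  proof
    assume B: "?B (f j)"
    have "(f ^^ m) j \<noteq> N" for m using B that by (cases m) (auto simp: funpow_swap1)
    then show "?B j" by blast
  next
    assume "?B j"
    then have "(f ^^ Suc m) j \<noteq> N" for m by blast
    then show "?B (f j)" by (simp add: funpow_swap1)
  qed
  have root: "\<not> ?B N" by (auto intro: exI[of _ 0])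
  have "(parent_mat N f *\<^sub>v v) $ j = 0" if j: "j < N" for j
  proof -
    have "(parent_mat N f *\<^sub>v v) $ j =
        (\<Sum>l = 0..<N. (of_bool (l = j) - of_bool (l = f j)) * of_bool (?B l))"
      using j by (simp add: parent_mat_def v_def scalar_prod_def)
    also have "\<dots> = (\<Sum>l = 0..<N. if l = j then of_bool (?B l) else 0) -
        (\<Sum>l = 0..<N. if l = f j then of_bool (?B l) else 0)"
      unfolding sum_subtractf[symmetric] by (rule sum.cong) auto
    also have "\<dots> = of_bool (?B j) - (if f j < N then of_bool (?B (f j)) else 0)"
      using j by (simp only: sum.delta finite_atLeastLessThan) simp
    also have "\<dots> = 0"
      using inv[OF j] root range[OF j] by (cases "f j = N") auto
    finally show ?thesis .
  qed
  then have "parent_mat N f *\<^sub>v v = 0\<^sub>v N"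
    by (intro eq_vecI) (auto simp: parent_mat_def)
  moreover have "v $ i = 1" using \<open>i < N\<close> lost by (simp add: v_def)
  then have "v \<noteq> 0\<^sub>v N" using \<open>i < N\<close> by auto
  moreover have "v \<in> carrier_vec N" by (simp add: v_def)
  ultimately show ?thesis using det_0_iff_vec_prod_zero[OF carr] by blast
qed

text \<open>
  Row \<open>i\<close> of the reduced Laplacian is the sum of \<open>e\<^sub>i - e\<^sub>v\<close> over the neighbours \<open>v\<close> of \<open>i\<close>.
  Expanding the determinant in every row means choosing a neighbour \<open>f i\<close> of every \<open>i\<close>, and the term
  of \<open>f\<close> is \<open>1\<close> if all vertices reach the root along \<open>f\<close> and \<open>0\<close> otherwise.
\<close>

theorem matrix_tree:
  assumes E: "\<And>e. e \<in> E \<Longrightarrow> e \<subseteq> {0..<Suc N} \<and> card e = 2"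
  shows "det (reduced_laplacian N E) = int (num_spanning_trees {0..<Suc N} E)"
proof -
  let ?V = "{0..<Suc N}"
  have VN: "?V - {N} = {0..<N}" by auto
  have loopless: "{i} \<notin> E" for i using E[of "{i}"] by auto
  define a :: "nat \<Rightarrow> nat \<Rightarrow> int vec" where
    "a i v = (if {i, v} \<in> E then vec N (\<lambda>j. of_bool (j = i) - of_bool (j = v)) else 0\<^sub>v N)" for i v
  let ?F = "{f. (\<forall>i\<in>{0..<N}. f i \<in> ?V) \<and> (\<forall>i. i \<notin> {0..<N} \<longrightarrow> f i = i)}"
  have a_carr: "a \<in> {0..<N} \<rightarrow> ?V \<rightarrow> carrier_vec N" by (auto simp: a_def)
  have "reduced_laplacian N E = mat\<^sub>r N N (\<lambda>i. finsum_vec TYPE(int) N (a i) ?V)"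
  proof (rule eq_matI)
    fix i j assume "i < dim_row (mat\<^sub>r N N (\<lambda>i. finsum_vec TYPE(int) N (a i) ?V))"
      "j < dim_col (mat\<^sub>r N N (\<lambda>i. finsum_vec TYPE(int) N (a i) ?V))"
    then have ij: "i < N" "j < N" by auto
    have carr: "finsum_vec TYPE(int) N (a i) ?V \<in> carrier_vec N"
      by (rule finsum_vec_closed) (auto simp: a_def)
    have "finsum_vec TYPE(int) N (a i) ?V $ j = (\<Sum>v\<in>?V. a i v $ j)"
      using ij by (intro index_finsum_vec) (auto simp: a_def)
    also have "\<dots> = (\<Sum>v\<in>?V. (if {i, v} \<in> E then of_bool (i = j) else 0) -
        (if v = j then of_bool ({i, j} \<in> E) else 0))"
      using ij by (intro sum.cong) (auto simp: a_def)
    also have "\<dots> = (\<Sum>v\<in>?V. if {i, v} \<in> E then of_bool (i = j) else 0) - of_bool ({i, j} \<in> E)"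
      using ij unfolding sum_subtractf by (simp only: sum.delta finite_atLeastLessThan) simp
    also have "(\<Sum>v\<in>?V. if {i, v} \<in> E then of_bool (i = j) else 0) =
        (if i = j then int (card {v \<in> ?V. {i, v} \<in> E}) else 0)"
      by (simp add: sum.inter_filter[symmetric] del: sum.op_ivl_Suc)
    finally show "reduced_laplacian N E $$ (i, j) =
        mat\<^sub>r N N (\<lambda>i. finsum_vec TYPE(int) N (a i) ?V) $$ (i, j)"
      using ij carr by (simp add: reduced_laplacian_def)
  qed (auto simp: reduced_laplacian_def)
  then have "det (reduced_laplacian N E) = (\<Sum>f\<in>?F. det (mat\<^sub>r N N (\<lambda>i. a i (f i))))"
    using det_linear_rows_sum[OF _ a_carr] by simp
  also have "\<dots> = (\<Sum>f\<in>?F. of_bool (f \<in> parent_maps ?V N E))"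
  proof (rule sum.cong[OF refl])
    fix f assume f: "f \<in> ?F"
    show "det (mat\<^sub>r N N (\<lambda>i. a i (f i))) = of_bool (f \<in> parent_maps ?V N E)"
    proof (cases "\<forall>i<N. {i, f i} \<in> E")
      case False
      then obtain i where i: "i < N" "{i, f i} \<notin> E" by blast
      have "mat\<^sub>r N N (\<lambda>i. a i (f i)) = mat\<^sub>r N N (\<lambda>j. if j = i then 0\<^sub>v N else a j (f j))"
        using i by (intro eq_matI) (auto simp: a_def)
      also have "det \<dots> = 0" using i f by (intro det_row_0) (auto simp: a_def)
      finally show ?thesis using i unfolding parent_maps_def VN by auto
    next
      case True
      then have P: "mat\<^sub>r N N (\<lambda>i. a i (f i)) = parent_mat N f"
        by (intro eq_matI) (auto simp: a_def parent_mat_def)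
      have moves: "f i \<noteq> i" if "i < N" for i using True loopless that by fastforce
      have range: "f i \<le> N" if "i < N" for i using f that by force
      show ?thesis
      proof (cases "\<forall>i<N. \<exists>m. (f ^^ m) i = N")
        case reach: True
        then have "f \<in> parent_maps ?V N E" using True f unfolding parent_maps_def VN by auto
        then show ?thesis using det_parent_mat_rooted[of N f] reach moves P by simp
      next
        case reach: False
        then obtain i where i: "i < N" "\<And>m. (f ^^ m) i \<noteq> N" by blast
        moreover have "i \<in> {0..<N}" using i(1) by simp
        ultimately have "f \<notin> parent_maps ?V N E" unfolding parent_maps_def VN by blast
        then show ?thesis using det_parent_mat_unrooted[of N f, OF range i] P by simp
      qed
    qed
  qed
  also have "\<dots> = int (card (?F \<inter> parent_maps ?V N E))"
  proof -
    have "finite ?F" by (rule finite_bounded_functions) auto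
    then show ?thesis by (simp only: sum_of_bool_eq Collect_mem_eq)
  qed
  also have "?F \<inter> parent_maps ?V N E = parent_maps ?V N E"
    using E unfolding parent_maps_def VN by fastforce
  also have "card (parent_maps ?V N E) = num_spanning_trees ?V E"
    unfolding num_spanning_trees_def
    by (rule bij_betw_same_card[OF spanning_trees_bij_parent_maps[OF _ E]]) auto
  finally show ?thesis .
qed

section \<open>Periodic sums and roots of unity\<close>

lemma sum_period_shift:
  fixes h :: "int \<Rightarrow> 'a::ab_group_add"
  assumes per: "\<And>x. h (x + int m) = h x"
  shows "(\<Sum>d<m. h (k + int d)) = (\<Sum>d<m. h (int d))"
proof -
  define S where "S k = (\<Sum>d<m. h (k + int d))" for k
  have step: "S (k + 1) = S k" for k
  proof -
    have "S (k + 1) - S k = (\<Sum>d<m. h (k + int (Suc d)) - h (k + int d))"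
      by (simp add: S_def sum_subtractf algebra_simps)
    also have "\<dots> = h (k + int m) - h (k + int 0)" by (rule sum_lessThan_telescope)
    finally show ?thesis using per[of k] by simp
  qed
  have "S k = S 0"
  proof (induction k rule: int_induct[of _ 0])
    case (step2 i)
    then show ?case using step[of "i - 1"] by simp
  qed (use step in auto)
  then show ?thesis by (simp add: S_def)
qed

lemma sum_period_reflect:
  fixes h :: "int \<Rightarrow> 'a::ab_group_add"
  assumes per: "\<And>x. h (x + int m) = h x"
  shows "(\<Sum>d<m. h (k - int d)) = (\<Sum>d<m. h (int d))"
proof -
  have "(\<Sum>d<m. h (k - int d)) = (\<Sum>d<m. h (k - int (m - Suc d)))"
    by (rule sum.nat_diff_reindex[symmetric])
  also have "\<dots> = (\<Sum>d<m. h ((k - int m + 1) + int d))"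
    by (intro sum.cong refl arg_cong[of _ _ h]) (auto simp: of_nat_diff)
  also have "\<dots> = (\<Sum>d<m. h (int d))" by (rule sum_period_shift[of h, OF per])
  finally show ?thesis .
qed

text \<open>
  The representatives \<open>- k, \<dots>, k + 1\<close> of the residues modulo \<open>2 (k + 1)\<close> are grouped into the two
  fixed points \<open>0\<close> and \<open>k + 1\<close> of negation and the pairs \<open>\<plusminus> j\<close>.
\<close>

lemma sum_fold:
  fixes h :: "int \<Rightarrow> 'a::ab_group_add"
  shows "(\<Sum>d<2 * Suc k. h (int d - int k)) =
           h 0 + h (int k + 1) + (\<Sum>j<k. h (int j + 1) + h (- (int j + 1)))"
proof (induction k)
  case 0
  show ?case by (simp add: numeral_2_eq_2)
next
  case (Suc k)
  have ends: "(\<Sum>d<Suc (Suc M). g d) = g 0 + (\<Sum>d<M. g (Suc d)) + g (Suc M)"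
    for g :: "nat \<Rightarrow> 'a" and M
    unfolding sum.lessThan_Suc[of g "Suc M"] sum.lessThan_Suc_shift[of g M] ..
  have "2 * Suc (Suc k) = Suc (Suc (2 * Suc k))" by simp
  then have "(\<Sum>d<2 * Suc (Suc k). h (int d - int (Suc k))) =
      h (int 0 - int (Suc k)) + (\<Sum>d<2 * Suc k. h (int (Suc d) - int (Suc k))) +
      h (int (Suc (2 * Suc k)) - int (Suc k))"
    by (simp only: ends)
  also have "\<dots> = h (- int (Suc k)) + (\<Sum>d<2 * Suc k. h (int d - int k)) + h (int k + 2)"
    by (simp add: algebra_simps del: sum.lessThan_Suc mult_Suc_right)
  finally show ?case using Suc by (simp add: algebra_simps)
qed

definition root_char :: "nat \<Rightarrow> int \<Rightarrow> complex" where
  "root_char m x = cis (2 * pi * of_int x / of_nat m)"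

lemma root_char_0 [simp]: "root_char m 0 = 1"
  by (simp add: root_char_def)

lemma root_char_add: "root_char m (x + y) = root_char m x * root_char m y"
  by (simp add: root_char_def cis_mult add_divide_distrib[symmetric] distrib_left)

lemma root_char_mult_nat: "root_char m (x * int d) = root_char m x ^ d"
  by (simp add: root_char_def DeMoivre mult_ac)

lemma root_char_eq_1_iff:
  assumes "m > 0"
  shows "root_char m x = 1 \<longleftrightarrow> int m dvd x"
proof
  assume "root_char m x = 1"
  then have "cos (2 * pi * of_int x / of_nat m) = 1"
    by (simp add: root_char_def complex_eq_iff)
  then obtain l :: int where "2 * pi * of_int x / of_nat m = of_int l * 2 * pi"
    unfolding cos_one_2pi_int by blast
  then have "real_of_int x = real_of_int (l * int m)"
    using assms by (simp add: field_simps)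
  then have "x = l * int m" by (simp only: of_int_eq_iff)
  then show "int m dvd x" by simp
next
  assume "int m dvd x"
  then obtain l where "x = int m * l" by blast
  then have "2 * pi * of_int x / of_nat m = 2 * pi * real_of_int l" using assms by simp
  then show "root_char m x = 1" unfolding root_char_def by (simp add: cis_multiple_2pi)
qed

lemma root_char_period:
  assumes "m > 0"
  shows "root_char m (x + int m * a) = root_char m x"
  using assms by (simp add: root_char_add root_char_eq_1_iff)

lemma root_char_sum:
  assumes "m > 0"
  shows "(\<Sum>d<m. root_char m (a * int d)) = (if int m dvd a then of_nat m else 0)"
proof (cases "int m dvd a")
  case True
  then have "root_char m a = 1" using assms by (simp add: root_char_eq_1_iff)
  then show ?thesis using True by (simp add: root_char_mult_nat)
next
  case False
  then have "root_char m a \<noteq> 1" using assms by (simp add: root_char_eq_1_iff)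
  moreover have "root_char m a ^ m = 1"
    using assms by (simp add: root_char_mult_nat[symmetric] root_char_eq_1_iff)
  ultimately show ?thesis using False by (simp add: root_char_mult_nat geometric_sum)
qed

section \<open>Determinants of circulant matrices\<close>

lemma int_diff_dvd_iff:
  assumes "i < m" "j < m"
  shows "int m dvd int i - int j \<longleftrightarrow> i = j"
  using zdvd_imp_le[of "int m" "int i - int j"] zdvd_imp_le[of "int m" "int j - int i"] assms
  by (cases i j rule: linorder_cases) (auto simp: dvd_diff_commute)

definition circulant_eigenvalue :: "nat \<Rightarrow> (int \<Rightarrow> complex) \<Rightarrow> int \<Rightarrow> complex" where
  "circulant_eigenvalue m l a = (\<Sum>d<m. l (int d) * root_char m (- a * int d))"

text \<open>
  Characters are eigenvectors of circulant matrices. The offset \<open>c\<close> allows for the index of a matrix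
  entry differing from the residue it stands for.
\<close>

lemma circulant_convolution:
  assumes "m > 0" and per: "\<And>x. l (x + int m) = l x"
  shows "(\<Sum>d<m. l (i - int d) * root_char m (a * (int d + c))) =
           circulant_eigenvalue m l a * root_char m (a * (i + c))"
proof -
  define h where "h x = l x * root_char m (a * (i - x + c))" for x
  have "h (x + int m) = h x" for x
    using root_char_period[OF \<open>m > 0\<close>, of "a * (i - x + c)" "- a"]
    by (simp add: h_def per algebra_simps)
  then have "(\<Sum>d<m. h (i - int d)) = (\<Sum>d<m. h (int d))" by (rule sum_period_reflect)
  also have "\<dots> = (\<Sum>d<m. l (int d) * root_char m (- a * int d) * root_char m (a * (i + c)))"
    by (simp add: h_def mult.assoc root_char_add[symmetric] algebra_simps)
  finally show ?thesis by (simp add: h_def circulant_eigenvalue_def sum_distrib_right)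
qed

lemma circulant_eigenvalue_uminus:
  assumes "m > 0" and per: "\<And>x. l (x + int m) = l x" and even: "\<And>x. l (- x) = l x"
  shows "circulant_eigenvalue m l (- a) = circulant_eigenvalue m l a"
proof -
  define h where "h x = l x * root_char m (- a * x)" for x
  have "h (x + int m) = h x" for x
    using root_char_period[OF \<open>m > 0\<close>, of "- a * x" "- a"]
    by (simp add: h_def per algebra_simps)
  then have "(\<Sum>d<m. h (0 - int d)) = (\<Sum>d<m. h (int d))" by (rule sum_period_reflect)
  then show ?thesis by (simp add: h_def circulant_eigenvalue_def even)
qed

lemma circulant_eigenvalue_period:
  assumes "m > 0"
  shows "circulant_eigenvalue m l (a + int m) = circulant_eigenvalue m l a"
  unfolding circulant_eigenvalue_def
proof (rule sum.cong[OF refl])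
  fix d
  show "l (int d) * root_char m (- (a + int m) * int d) = l (int d) * root_char m (- a * int d)"
    using root_char_period[OF assms, of "- a * int d" "- int d"] by (simp add: algebra_simps)
qed

text \<open>
  Adding row \<open>0\<close> to all the others (\<open>P\<close> on the left) turns the matrix \<open>W\<close> into the given one, and
  summing all columns into column \<open>0\<close> (\<open>P\<close> on the right) turns \<open>W\<close> into an upper triangular \<open>T\<close>.
\<close>

lemma det_one_plus_all_ones:
  "det (mat N N (\<lambda>(i, j). of_bool (i = j) + 1) :: 'a::{idom} mat) = of_nat N + 1"
proof (cases "N = 0")
  case False
  let ?D = "mat N N (\<lambda>(i, j). of_bool (i = j) + 1) :: 'a mat"
  define P :: "'a mat" where "P = mat N N (\<lambda>(i, j). of_bool (i = j) + of_bool (j = 0 \<and> i \<noteq> 0))"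
  define W :: "'a mat" where "W = mat N N (\<lambda>(i, j). of_bool (i = j) + of_bool (i = 0) - of_bool (j = 0 \<and> i \<noteq> 0))"
  define T :: "'a mat" where "T = mat N N (\<lambda>(i, j). of_bool (i = j) +
     of_bool (i = 0) * (if j = 0 then of_nat N else 1))"
  have carr: "?D \<in> carrier_mat N N" "P \<in> carrier_mat N N" "W \<in> carrier_mat N N" "T \<in> carrier_mat N N"
    by (simp_all add: P_def W_def T_def)
  have "P * W = ?D"
  proof (rule eq_matI)
    fix i j assume "i < dim_row ?D" "j < dim_col ?D"
    then have ij: "i < N" "j < N" by auto
    have "(P * W) $$ (i, j) = (\<Sum>k = 0..<N. P $$ (i, k) * W $$ (k, j))"
      using ij carr by (simp add: scalar_prod_def)
    also have "\<dots> = (\<Sum>k = 0..<N. (if k = i then W $$ (i, j) else 0) +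
        (if k = 0 then of_bool (i \<noteq> 0) * W $$ (0, j) else 0))"
      using ij by (intro sum.cong refl) (auto simp: P_def)
    also have "\<dots> = W $$ (i, j) + of_bool (i \<noteq> 0) * W $$ (0, j)"
      using ij unfolding sum.distrib by (simp only: sum.delta finite_atLeastLessThan) simp
    finally show "(P * W) $$ (i, j) = ?D $$ (i, j)"
      using ij by (auto simp: W_def)
  qed (use carr in auto)
  then have "det ?D = det P * det W" using det_mult[OF carr(2,3)] by simp
  moreover have "W * P = T"
  proof (rule eq_matI)
    fix i j assume "i < dim_row T" "j < dim_col T"
    then have ij: "i < N" "j < N" using carr by auto
    have W0: "(\<Sum>k = 0..<N. W $$ (i, k)) = (if i = 0 then of_nat N + 1 else 0)"
    proof -
      have "(\<Sum>k = 0..<N. W $$ (i, k)) = (\<Sum>k = 0..<N. (if k = i then 1 else 0) + of_bool (i = 0)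
         - (if k = 0 then of_bool (i \<noteq> 0) else 0))"
        using ij by (intro sum.cong refl) (auto simp: W_def)
      also have "\<dots> = (if i = 0 then of_nat N + 1 else 0)"
        using ij unfolding sum.distrib sum_subtractf 
        by (simp only: sum.delta finite_atLeastLessThan) simp
      finally show ?thesis .
    qed
    have "(W * P) $$ (i, j) = (\<Sum>k = 0..<N. W $$ (i, k) * P $$ (k, j))"
      using ij carr by (simp add: scalar_prod_def)
    also have "\<dots> = (if j = 0 then \<Sum>k = 0..<N. W $$ (i, k) else W $$ (i, j))"
    proof (cases "j = 0")
      case True
      then show ?thesis using ij by (auto simp: P_def intro!: sum.cong)
    next
      case False
      then have "(\<Sum>k = 0..<N. W $$ (i, k) * P $$ (k, j)) = (\<Sum>k = 0..<N. if k = j then W $$ (i, j) else 0)"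
        using ij by (intro sum.cong refl) (auto simp: P_def)
      also have "\<dots> = W $$ (i, j)" using ij by (simp only: sum.delta finite_atLeastLessThan) simp
      finally show ?thesis using False by simp
    qed
    finally show "(W * P) $$ (i, j) = T $$ (i, j)"
      unfolding W0 using ij by (auto simp: W_def T_def)
  qed (use carr in auto)
  then have "det W * det P = det T" using det_mult[OF carr(3,2)] by simp
  moreover have "det T = of_nat N + 1"
  proof -
    have "det T = prod_list (diag_mat T)"
      by (rule det_upper_triangular[OF _ carr(4)]) (auto simp: T_def)
    also have "\<dots> = (\<Prod>i = 0..<N. 1 + of_bool (i = 0) * of_nat N)"
      using carr(4) by (auto simp: prod_list_diag_prod T_def intro!: prod.cong)
    also have "\<dots> = of_nat N + 1"
      using False by (subst prod.remove[of _ 0]) (auto intro!: prod.neutral)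
    finally show ?thesis .
  qed
  ultimately show ?thesis by (simp add: mult.commute)
qed simp

lemma det_mat_diag: "det (mat_diag N f) = (\<Prod>i<N. f i :: 'a::comm_ring_1)"
proof -
  have "det (mat_diag N f) = prod_list (diag_mat (mat_diag N f))"
    by (rule det_upper_triangular[of _ N]) (auto simp: mat_diag_def)
  also have "\<dots> = (\<Prod>i<N. f i)"
    by (auto simp: mat_diag_def prod_list_diag_prod lessThan_atLeast0 intro!: prod.cong)
  finally show ?thesis .
qed

text \<open>
  The index \<open>i\<close> stands for the residue \<open>i + 1\<close>, so that the deleted index \<open>N\<close> is the residue \<open>0\<close>.
  The columns of \<open>F\<close> are the nontrivial characters minus \<open>1\<close>. They vanish at the deleted residue, so
  the reduced matrix \<open>L\<close> acts on them like the full one, and the constant \<open>1\<close> is killed: \<open>L F\<close> is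
  \<open>K \<Lambda>\<close> with the characters themselves in \<open>K\<close>. Now \<open>det F\<close> and \<open>det K\<close> differ by the factor \<open>N + 1\<close>,
  since the nontrivial characters sum to \<open>- 1\<close> away from the residue \<open>0\<close>, that is, \<open>F = K D\<close>.
\<close>

theorem det_reduced_circulant:
  fixes l :: "int \<Rightarrow> complex"
  assumes per: "\<And>x. l (x + int (Suc N)) = l x" and sum0: "(\<Sum>d<Suc N. l (int d)) = 0"
  shows "of_nat (Suc N) * det (mat N N (\<lambda>(i, j). l (int i - int j))) =
           (\<Prod>a<N. circulant_eigenvalue (Suc N) l (int a + 1))"
proof -
  let ?m = "Suc N"
  let ?e = "root_char ?m"
  let ?x = "\<lambda>i. int i + 1"
  define L where "L = mat N N (\<lambda>(i, j). l (int i - int j))"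
  define K where "K = mat N N (\<lambda>(i, a). ?e (?x a * ?x i))"
  define F where "F = mat N N (\<lambda>(i, a). ?e (?x a * ?x i) - 1)"
  define F' where "F' = mat N N (\<lambda>(a, j). ?e (- (?x a * ?x j)) - 1)"
  define D :: "complex mat" where "D = mat N N (\<lambda>(i, j). of_bool (i = j) + 1)"
  define \<Lambda> where "\<Lambda> = mat_diag N (\<lambda>a. circulant_eigenvalue ?m l (?x a))"
  have carr: "L \<in> carrier_mat N N" "K \<in> carrier_mat N N" "F \<in> carrier_mat N N"
    "F' \<in> carrier_mat N N" "D \<in> carrier_mat N N" "\<Lambda> \<in> carrier_mat N N"
    by (simp_all add: L_def K_def F_def F'_def D_def \<Lambda>_def)
  have full: "(\<Sum>j<N. f j) = (\<Sum>j<?m. f j)" if "f N = 0" for f :: "nat \<Rightarrow> complex"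
    using that by simp
  have root: "?e (b * ?x N) = 1" for b
    using root_char_eq_1_iff[of ?m "b * ?x N"] by (simp add: add.commute)
  have not_dvd: "\<not> int ?m dvd ?x a" if "a < N" for a
    using zdvd_not_zless[of "?x a" "int ?m"] that by simp
  have "L * F = K * \<Lambda>"
  proof (rule eq_matI)
    fix i a assume "i < dim_row (K * \<Lambda>)" "a < dim_col (K * \<Lambda>)"
    then have ia: "i < N" "a < N" using carr by auto
    have "(L * F) $$ (i, a) = (\<Sum>j<N. l (int i - int j) * (?e (?x a * ?x j) - 1))"
      using ia by (simp add: L_def F_def scalar_prod_def lessThan_atLeast0)
    also have "\<dots> = (\<Sum>j<?m. l (int i - int j) * (?e (?x a * ?x j) - 1))"
      by (rule full) (simp add: root)
    also have "\<dots> = (\<Sum>j<?m. l (int i - int j) * ?e (?x a * (int j + 1))) - (\<Sum>j<?m. l (int i - int j))"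
      unfolding sum_subtractf[symmetric] by (rule sum.cong) (auto simp: algebra_simps)
    also have "(\<Sum>j<?m. l (int i - int j)) = 0"
      using sum_period_reflect[of l, OF per] sum0 by simp
    finally show "(L * F) $$ (i, a) = (K * \<Lambda>) $$ (i, a)"
      unfolding circulant_convolution[of ?m l, OF zero_less_Suc per] \<Lambda>_def mat_diag_mult_right[OF carr(2)]
      using ia by (simp add: K_def mult.commute)
  qed (use carr in auto)
  then have "det L * det F = det K * det \<Lambda>"
    using det_mult[OF carr(1,3)] det_mult[OF carr(2,6)] by simp
  moreover have "F = K * D"
  proof (rule eq_matI)
    fix i a assume "i < dim_row (K * D)" "a < dim_col (K * D)"
    then have ia: "i < N" "a < N" using carr by auto
    have "(K * D) $$ (i, a) = (\<Sum>b<N. ?e (?x b * ?x i) * (of_bool (b = a) + 1))"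
      using ia by (simp add: K_def D_def scalar_prod_def lessThan_atLeast0)
    also have "\<dots> = (\<Sum>b<N. if b = a then ?e (?x a * ?x i) else 0) + (\<Sum>b<N. ?e (?x b * ?x i))"
      unfolding sum.distrib[symmetric] by (rule sum.cong) (auto simp: algebra_simps)
    also have "(\<Sum>b<N. if b = a then ?e (?x a * ?x i) else 0) = ?e (?x a * ?x i)"
      using ia by simp
    also have "(\<Sum>b<N. ?e (?x b * ?x i)) = (\<Sum>b<?m. ?e (?x i * int b)) - 1"
      unfolding sum.lessThan_Suc_shift by (simp add: mult.commute add.commute)
    also have "\<dots> = - 1" using not_dvd[OF ia(1)] by (simp only: root_char_sum[OF zero_less_Suc]) simp
    finally show "F $$ (i, a) = (K * D) $$ (i, a)" using ia by (simp add: F_def)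
  qed (use carr in auto)
  then have "det F = det K * of_nat ?m"
    using det_mult[OF carr(2,5)] det_one_plus_all_ones[where 'a = complex] by (simp add: D_def)
  \<comment> \<open>Orthogonality of characters: \<open>K\<close> is invertible, so \<open>det K\<close> cancels.\<close>
  moreover have "K * F' = mat_diag N (\<lambda>_. of_nat ?m)" (is "_ = ?M")
  proof (rule eq_matI)
    fix i j assume "i < dim_row ?M" "j < dim_col ?M"
    then have ij: "i < N" "j < N" by (auto simp: mat_diag_def)
    have "(K * F') $$ (i, j) = (\<Sum>a<N. ?e (?x a * ?x i) * (?e (- (?x a * ?x j)) - 1))"
      using ij by (simp add: K_def F'_def scalar_prod_def lessThan_atLeast0)
    also have "\<dots> = (\<Sum>a<N. ?e ((int i - int j) * int (Suc a)) - ?e (?x i * int (Suc a)))"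
      by (rule sum.cong) (simp_all add: right_diff_distrib root_char_add[symmetric] algebra_simps)
    also have "\<dots> = (\<Sum>a<?m. ?e ((int i - int j) * int a)) - (\<Sum>a<?m. ?e (?x i * int a))"
      unfolding sum.lessThan_Suc_shift by (simp add: sum_subtractf)
    also have "\<dots> = (if int ?m dvd int i - int j then of_nat ?m else 0)"
      using not_dvd[OF ij(1)] by (simp only: root_char_sum[OF zero_less_Suc]) simp
    also have "int ?m dvd int i - int j \<longleftrightarrow> i = j"
      using int_diff_dvd_iff[of i ?m j] ij by simp
    finally show "(K * F') $$ (i, j) = ?M $$ (i, j)" using ij by (simp add: mat_diag_def)
  qed (use carr in \<open>auto simp: mat_diag_def\<close>)
  then have "det K * det F' = of_nat ?m ^ N"
    using det_mult[OF carr(2,4)] by (simp only: det_mat_diag) simp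
  then have "det K \<noteq> 0" by (metis mult_zero_left of_nat_eq_0_iff power_not_zero Suc_neq_Zero)
  moreover have "det \<Lambda> = (\<Prod>a<N. circulant_eigenvalue ?m l (?x a))"
    unfolding \<Lambda>_def by (rule det_mat_diag)
  ultimately show ?thesis unfolding L_def by (simp add: mult_ac)
qed

text \<open>
  The circulant matrix with symbol \<open>l\<close> modulo \<open>2 (k + 1)\<close>, acting on odd functions, in the basis
  \<open>e\<^sub>j - e\<^sub>-\<^sub>j\<close> for \<open>0 < j \<le> k\<close>. Indices are shifted by one: for the residues \<open>i + 1\<close> and \<open>j + 1\<close> the
  entry is \<open>l\<close> at their difference minus \<open>l\<close> at their sum.
\<close>

definition odd_part_mat :: "nat \<Rightarrow> (int \<Rightarrow> 'a) \<Rightarrow> 'a::ab_group_add mat" where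
  "odd_part_mat k l = mat k k (\<lambda>(i, j). l (int i - int j) - l (int i + int j + 2))"

text \<open>
  The odd functions are spanned by the eigenvectors \<open>w\<^sup>a\<^sup>x - w\<^sup>-\<^sup>a\<^sup>x\<close> with \<open>0 < a \<le> k\<close>, where \<open>w\<close> is a
  primitive \<open>2 (k + 1)\<close>-th root of unity. These are the columns of \<open>S\<close>. Sums over half a period are
  completed to full periods by \<open>sum_fold\<close>, because odd functions vanish at \<open>0\<close> and at \<open>k + 1\<close>.
\<close>

theorem det_odd_part:
  fixes l :: "int \<Rightarrow> complex"
  assumes per: "\<And>x. l (x + int (2 * Suc k)) = l x" and even: "\<And>x. l (- x) = l x"
  shows "det (odd_part_mat k l) = (\<Prod>a<k. circulant_eigenvalue (2 * Suc k) l (int a + 1))"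
proof -
  let ?m = "2 * Suc k"
  let ?e = "root_char ?m"
  let ?x = "\<lambda>i. int i + 1"
  let ?g = "\<lambda>a x. ?e (a * x) - ?e (- a * x)"
  let ?ev = "circulant_eigenvalue ?m l"
  have m: "?m > 0" by simp
  define S where "S = mat k k (\<lambda>(i, a). ?g (?x a) (?x i))"
  define \<Lambda> where "\<Lambda> = mat_diag k (\<lambda>a. ?ev (?x a))"
  have carr: "odd_part_mat k l \<in> carrier_mat k k" "S \<in> carrier_mat k k" "\<Lambda> \<in> carrier_mat k k"
    by (simp_all add: odd_part_mat_def S_def \<Lambda>_def)
  have g_per: "?g a (x + int ?m) = ?g a x" for a x
    using root_char_period[OF m, of "a * x" a] root_char_period[OF m, of "- a * x" "- a"]
    by (simp add: algebra_simps)
  have g_sym: "?g a x = ?g x a" for a x by (simp add: mult.commute)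
  have g_mult: "?g x z * ?g y z =
      ?e ((x + y) * z) + ?e (- (x + y) * z) - ?e ((x - y) * z) - ?e (- (x - y) * z)" for x y z
  proof -
    have "?e ((x + y) * z) = ?e (x * z) * ?e (y * z)" "?e (- (x + y) * z) = ?e (- x * z) * ?e (- y * z)"
      "?e ((x - y) * z) = ?e (x * z) * ?e (- y * z)" "?e (- (x - y) * z) = ?e (- x * z) * ?e (y * z)"
      by (simp_all add: root_char_add[symmetric] algebra_simps)
    then show ?thesis by (simp only: left_diff_distrib right_diff_distrib) (simp only: algebra_simps)
  qed
  have g_half: "?g a (int k + 1) = 0" for a
    using root_char_period[OF m, of "- a * (int k + 1)" a] by (simp add: algebra_simps)
  have fold: "(\<Sum>d<?m. h (int d)) = (\<Sum>j<k. h (?x j) + h (- ?x j))"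
    if "\<And>x. h (x + int ?m) = h x" "h 0 = 0" "h (int k + 1) = 0" for h :: "int \<Rightarrow> complex"
    using sum_period_shift[of h ?m "- int k", OF that(1)] sum_fold[of h k] that(2,3)
    by (simp add: add.commute)
  have "odd_part_mat k l * S = S * \<Lambda>"
  proof (rule eq_matI)
    fix i a assume "i < dim_row (S * \<Lambda>)" "a < dim_col (S * \<Lambda>)"
    then have ia: "i < k" "a < k" using carr by auto
    define h where "h x = l (?x i - x) * ?g (?x a) x" for x
    have l_per: "l (x - int ?m) = l x" for x using per[of "x - int ?m"] by simp
    have "(odd_part_mat k l * S) $$ (i, a) =
        (\<Sum>j<k. (l (int i - int j) - l (int i + int j + 2)) * ?g (?x a) (?x j))"
      using ia by (simp add: odd_part_mat_def S_def scalar_prod_def lessThan_atLeast0)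
    also have "\<dots> = (\<Sum>j<k. h (?x j) + h (- ?x j))"
      by (rule sum.cong) (simp_all add: h_def algebra_simps)
    also have "\<dots> = (\<Sum>d<?m. h (int d))"
    proof (rule fold[symmetric])
      show "h (x + int ?m) = h x" for x
        unfolding h_def g_per using l_per[of "?x i - x"] by (simp add: algebra_simps)
      show "h 0 = 0" by (simp add: h_def)
      show "h (int k + 1) = 0" unfolding h_def g_half by simp
    qed
    also have "\<dots> = (\<Sum>d<?m. l (?x i - int d) * ?e (?x a * (int d + 0))) -
        (\<Sum>d<?m. l (?x i - int d) * ?e (- ?x a * (int d + 0)))"
      unfolding sum_subtractf[symmetric] by (simp add: h_def right_diff_distrib)
    also have "\<dots> = ?ev (?x a) * ?g (?x a) (?x i)"
      unfolding circulant_convolution[of ?m l, OF m per] 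
        circulant_eigenvalue_uminus[of ?m l, OF m per even] by (simp add: right_diff_distrib)
    finally show "(odd_part_mat k l * S) $$ (i, a) = (S * \<Lambda>) $$ (i, a)"
      unfolding \<Lambda>_def mat_diag_mult_right[OF carr(2)] using ia by (simp add: S_def mult.commute)
  qed (use carr in auto)
  then have *: "det S * det (odd_part_mat k l) = det S * det \<Lambda>"
    using det_mult[OF carr(1,2)] det_mult[OF carr(2,3)] by (metis mult.commute)
  \<comment> \<open>\<open>S\<close> is, up to the factor \<open>2 \<i>\<close>, the sine matrix, whose square is scalar; so \<open>det S\<close> cancels.\<close>
  have "S * S = mat_diag k (\<lambda>_. - of_nat ?m)" (is "_ = ?M")
  proof (rule eq_matI)
    fix i b assume "i < dim_row ?M" "b < dim_col ?M"
    then have ib: "i < k" "b < k" by (auto simp: mat_diag_def)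
    define h where "h x = ?g (?x i) x * ?g (?x b) x" for x
    have h_even: "h (- x) = h x" for x by (simp add: h_def algebra_simps)
    have "(S * S) $$ (i, b) = (\<Sum>j<k. ?g (?x j) (?x i) * ?g (?x b) (?x j))"
      using ib by (simp add: S_def scalar_prod_def lessThan_atLeast0)
    also have "\<dots> = (\<Sum>j<k. h (?x j))"
      unfolding h_def by (intro sum.cong refl arg_cong2[of _ _ _ _ "(*)"] g_sym)
    finally have SS: "(S * S) $$ (i, b) = (\<Sum>j<k. h (?x j))" .
    have "2 * (\<Sum>j<k. h (?x j)) = (\<Sum>j<k. h (?x j) + h (- ?x j))"
      by (simp only: h_even sum.distrib mult_2)
    also have "\<dots> = (\<Sum>d<?m. h (int d))"
    proof (rule fold[symmetric])
      show "h (x + int ?m) = h x" for x unfolding h_def g_per ..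
      show "h 0 = 0" by (simp add: h_def)
      show "h (int k + 1) = 0" unfolding h_def g_half by simp
    qed
    also have "\<dots> = (\<Sum>d<?m. ?e ((?x i + ?x b) * int d)) + (\<Sum>d<?m. ?e (- (?x i + ?x b) * int d))
        - (\<Sum>d<?m. ?e ((?x i - ?x b) * int d)) - (\<Sum>d<?m. ?e (- (?x i - ?x b) * int d))"
      unfolding sum_subtractf[symmetric] sum.distrib[symmetric]
      unfolding h_def g_mult ..
    also have "\<dots> = - 2 * (if int ?m dvd ?x i - ?x b then of_nat ?m else 0)"
    proof -
      have "\<not> int ?m dvd ?x i + ?x b"
        using zdvd_not_zless[of "?x i + ?x b" "int ?m"] ib by simp
      then show ?thesis unfolding root_char_sum[OF m] dvd_minus_iff by simp
    qed
    also have "int ?m dvd ?x i - ?x b \<longleftrightarrow> i = b"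
      using int_diff_dvd_iff[of i ?m b] ib by simp
    finally have "(\<Sum>j<k. h (?x j)) = - (if i = b then of_nat ?m else 0)" by simp
    then show "(S * S) $$ (i, b) = ?M $$ (i, b)" unfolding SS using ib by (simp add: mat_diag_def)
  qed (use carr in \<open>auto simp: mat_diag_def\<close>)
  then have "det S * det S = (- of_nat ?m) ^ k"
    using det_mult[OF carr(2,2)] by (simp only: det_mat_diag) simp
  moreover have "(- of_nat ?m :: complex) ^ k \<noteq> 0"
    by (intro power_not_zero) (simp only: neg_equal_0_iff_equal of_nat_eq_0_iff, simp)
  ultimately have "det S \<noteq> 0" by (metis mult_zero_left)
  with * have "det (odd_part_mat k l) = det \<Lambda>" by simp
  also have "\<dots> = (\<Prod>a<k. ?ev (?x a))"
    unfolding \<Lambda>_def by (rule det_mat_diag)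
  finally show ?thesis .
qed

section \<open>Circulant graphs with an even number of vertices\<close>

text \<open>
  Modulo \<open>n = k + 1\<close> the row vector \<open>(1, \<dots>, k)\<close> annihilates the matrix: its product with the column
  of residue \<open>b\<close> is, by \<open>sum_fold\<close>, congruent to the sum of \<open>d * l (d - b)\<close> over a full period.
  Substituting \<open>d + b\<close> for \<open>d\<close> removes the dependence on \<open>b\<close>, as \<open>l\<close> sums to zero, and for \<open>b = 0\<close>
  the terms of \<open>d\<close> and \<open>- d\<close> cancel.
\<close>

theorem dvd_det_odd_part:
  fixes l :: "int \<Rightarrow> int"
  assumes per: "\<And>x. l (x + int (2 * Suc k)) = l x" and even: "\<And>x. l (- x) = l x"
    and sum0: "(\<Sum>d<2 * Suc k. l (int d)) = 0"
  shows "int (Suc k) dvd det (odd_part_mat k l)"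
proof (cases "k = 0")
  case False
  let ?m = "2 * Suc k"
  let ?n = "int (Suc k)"
  let ?x = "\<lambda>i. int i + 1"
  have moment: "?n dvd (\<Sum>i<k. ?x i * (l (?x i - b) - l (?x i + b)))" for b
  proof -
    have shift: "[(\<Sum>d<?m. int d * l (int d - b)) = (\<Sum>d<?m. (a + int d) * l (a + int d - b))]
      (mod ?n)" for a b
    proof -
      \<comment> \<open>The factor \<open>x\<close> is not periodic; its residue modulo \<open>n\<close> is, so the sum of \<open>h\<close> can be shifted.\<close>
      define h where "h x = (x mod ?n) * l (x - b)" for x
      have "h (x + int ?m) = h x" for x
      proof -
        have "x + int ?m = x + ?n * 2" by simp
        then have "(x + int ?m) mod ?n = x mod ?n" by (metis mod_mult_self2)
        then show ?thesis using per[of "x - b"] by (simp add: h_def algebra_simps)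
      qed
      then have period: "(\<Sum>d<?m. h (a + int d)) = (\<Sum>d<?m. h (int d))"
        by (rule sum_period_shift)
      have h: "[h x = x * l (x - b)] (mod ?n)" for x
        unfolding h_def by (intro cong_mult) (auto simp: cong_def)
      have "[(\<Sum>d<?m. int d * l (int d - b)) = (\<Sum>d<?m. h (int d))] (mod ?n)"
        by (intro cong_sum cong_sym[OF h])
      also have "[(\<Sum>d<?m. h (int d)) = (\<Sum>d<?m. (a + int d) * l (a + int d - b))] (mod ?n)"
        unfolding period[symmetric] by (intro cong_sum h)
      finally show ?thesis .
    qed
    have folded: "[(\<Sum>d<?m. int d * l (int d - b)) = (\<Sum>i<k. ?x i * (l (?x i - b) - l (?x i + b)))]
      (mod ?n)" for b
    proof -
      have reflect: "l (- ?x j - b) = l (?x j + b)" for j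
        using even[of "?x j + b"] by (simp add: algebra_simps)
      have "(\<Sum>d<?m. (- int k + int d) * l (- int k + int d - b)) =
          ?n * l (?n - b) + (\<Sum>j<k. ?x j * l (?x j - b) + (- ?x j) * l (- ?x j - b))"
        using sum_fold[of "\<lambda>x. x * l (x - b)" k] by (simp add: add.commute)
      also have "(\<Sum>j<k. ?x j * l (?x j - b) + (- ?x j) * l (- ?x j - b)) =
          (\<Sum>i<k. ?x i * (l (?x i - b) - l (?x i + b)))"
        unfolding reflect by (rule sum.cong) (simp_all add: algebra_simps)
      finally show ?thesis using shift[of b "- int k"] by (simp add: cong_def)
    qed
    have "[(\<Sum>d<?m. int d * l (int d - b)) = (\<Sum>d<?m. int d * l (int d))] (mod ?n)"
    proof -
      have "(\<Sum>d<?m. (b + int d) * l (b + int d - b)) =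
          b * (\<Sum>d<?m. l (int d)) + (\<Sum>d<?m. int d * l (int d))"
        by (simp only: sum_distrib_left sum.distrib[symmetric]) (simp add: algebra_simps)
      then show ?thesis using shift[of b b] unfolding sum0 by simp
    qed
    then have "[(\<Sum>i<k. ?x i * (l (?x i - b) - l (?x i + b))) =
        (\<Sum>i<k. ?x i * (l (?x i - 0) - l (?x i + 0)))] (mod ?n)"
      using folded[of b] folded[of 0] by (simp add: cong_def)
    then show ?thesis by (simp add: cong_0_iff)
  qed
  \<comment> \<open>The first entry of \<open>(1, \<dots>, k)\<close> is \<open>1\<close>, so replacing row \<open>0\<close> by this combination of rows is unimodular.\<close>
  define R :: "int mat" where
    "R = mat k k (\<lambda>(i, j). if i = 0 then ?x j else of_bool (i = j))"
  let ?A = "odd_part_mat k l"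
  have carr: "R \<in> carrier_mat k k" "?A \<in> carrier_mat k k" by (simp_all add: R_def odd_part_mat_def)
  have "det R = prod_list (diag_mat R)"
    by (rule det_upper_triangular[OF _ carr(1)]) (auto simp: R_def)
  also have "\<dots> = 1" by (auto simp: prod_list_diag_prod R_def intro!: prod.neutral)
  finally have "det (R * ?A) = det ?A" using det_mult[OF carr] by simp
  moreover have "?n dvd det (R * ?A)"
  proof -
    have row: "?n dvd (R * ?A) $$ (0, j)" if "j < k" for j
    proof -
      have "(R * ?A) $$ (0, j) = (\<Sum>i<k. ?x i * (l (?x i - ?x j) - l (?x i + ?x j)))"
        using that False
        by (simp add: R_def odd_part_mat_def scalar_prod_def lessThan_atLeast0 algebra_simps)
      then show ?thesis by (simp only: moment)
    qed
    have RA: "R * ?A \<in> carrier_mat k k" using carr by simp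
    show ?thesis unfolding det_def'[OF RA]
    proof (intro dvd_sum dvd_mult)
      fix p assume "p \<in> {p. p permutes {0..<k}}"
      then have "p 0 < k" using False permutes_in_image[of p "{0..<k}" 0] by simp
      then have "?n dvd (R * ?A) $$ (0, p 0)" by (rule row)
      also have "(R * ?A) $$ (0, p 0) dvd (\<Prod>i = 0..<k. (R * ?A) $$ (i, p i))"
        using False by (intro dvd_prodI) auto
      finally show "?n dvd (\<Prod>i = 0..<k. (R * ?A) $$ (i, p i))" .
    qed
  qed
  ultimately show ?thesis by simp
qed simp

text \<open>
  At \<open>k + 1\<close>, half of the modulus, the character takes the values \<open>(- 1)\<^sup>d\<close>.
\<close>

lemma circulant_eigenvalue_half:
  "circulant_eigenvalue (2 * Suc k) (\<lambda>x. of_int (l x)) (int k + 1) =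
     of_int (\<Sum>d<2 * Suc k. l (int d) * (- 1) ^ d)"
proof -
  have "2 * pi * of_int (- (int k + 1)) / of_nat (2 * Suc k) = - pi" by (simp add: field_simps)
  then have "root_char (2 * Suc k) (- (int k + 1)) = - 1"
    unfolding root_char_def by (simp add: complex_eq_iff)
  then show ?thesis
    unfolding circulant_eigenvalue_def root_char_mult_nat by simp
qed

text \<open>
  In the product over all nonzero residues the eigenvalues of \<open>a\<close> and \<open>- a\<close> are equal, and only
  \<open>a = k + 1\<close> is its own negative.
\<close>

theorem det_reduced_even_circulant:
  fixes l :: "int \<Rightarrow> int"
  assumes per: "\<And>x. l (x + int (2 * Suc k)) = l x" and even: "\<And>x. l (- x) = l x"
    and sum0: "(\<Sum>d<2 * Suc k. l (int d)) = 0"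
  shows "int (2 * Suc k) * det (mat (2 * k + 1) (2 * k + 1) (\<lambda>(i, j). l (int i - int j))) =
           (\<Sum>d<2 * Suc k. l (int d) * (- 1) ^ d) * (det (odd_part_mat k l))\<^sup>2"
proof -
  let ?m = "2 * Suc k"
  let ?N = "2 * k + 1"
  let ?l = "\<lambda>x. complex_of_int (l x)"
  let ?ev = "circulant_eigenvalue ?m ?l"
  have m: "?m = Suc ?N" by simp
  have reflect: "?ev (int ?m - a) = ?ev a" for a
    using circulant_eigenvalue_period[of ?m ?l "- a"] circulant_eigenvalue_uminus[of ?m ?l a] per even
    by simp
  have "of_nat ?m * det (mat ?N ?N (\<lambda>(i, j). ?l (int i - int j))) = (\<Prod>a<?N. ?ev (int a + 1))"
    unfolding m using per sum0 unfolding m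
    by (intro det_reduced_circulant) (simp_all only: of_int_sum[symmetric] of_int_0)
  also have "\<dots> = (\<Prod>a<Suc k. ?ev (int a + 1)) * (\<Prod>a<k. ?ev (int (Suc k + a) + 1))"
  proof -
    have "(\<Prod>a<x + y. f a) = (\<Prod>a<x. f a) * (\<Prod>a<y. f (x + a))" for f :: "nat \<Rightarrow> complex" and x y
      by (induction y) (simp_all add: mult.assoc)
    moreover have "?N = Suc k + k" by simp
    ultimately show ?thesis by (simp only:)
  qed
  also have "(\<Prod>a<k. ?ev (int (Suc k + a) + 1)) = (\<Prod>a<k. ?ev (int (Suc k + (k - Suc a)) + 1))"
    by (rule prod.nat_diff_reindex[symmetric])
  also have "\<dots> = (\<Prod>a<k. ?ev (int ?m - (int a + 1)))"
    by (intro prod.cong refl arg_cong[of _ _ ?ev]) (auto simp: of_nat_diff)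
  also have "\<dots> = (\<Prod>a<k. ?ev (int a + 1))" unfolding reflect ..
  also have "(\<Prod>a<Suc k. ?ev (int a + 1)) = ?ev (int k + 1) * (\<Prod>a<k. ?ev (int a + 1))"
    by simp
  also have "(\<Prod>a<k. ?ev (int a + 1)) = det (odd_part_mat k ?l)"
    using per even by (intro det_odd_part[symmetric]) (simp_all only:)
  also have "odd_part_mat k ?l = map_mat of_int (odd_part_mat k l)"
    by (intro eq_matI) (auto simp: odd_part_mat_def)
  also have "mat ?N ?N (\<lambda>(i, j). ?l (int i - int j)) =
      map_mat of_int (mat ?N ?N (\<lambda>(i, j). l (int i - int j)))"
    by (intro eq_matI) auto
  finally have "complex_of_int (int ?m * det (mat ?N ?N (\<lambda>(i, j). l (int i - int j)))) =
      of_int ((\<Sum>d<?m. l (int d) * (- 1) ^ d) * (det (odd_part_mat k l))\<^sup>2)"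
    unfolding circulant_eigenvalue_half of_int_hom.hom_det
    by (simp only: of_int_mult of_int_power power2_eq_square mult.assoc of_int_of_nat_eq)
  then show ?thesis by (simp only: of_int_eq_iff)
qed

lemma sum_of_bool_card: "(\<Sum>d<m. of_bool (P d)) = int (card {d::nat. d < m \<and> P d})"
proof -
  have "{..<m} \<inter> {d. P d} = {d. d < m \<and> P d}" by auto
  then show ?thesis by (simp only: sum_of_bool_eq finite_lessThan)
qed

text \<open>
  The Laplacian of the circulant graph in which \<open>i\<close> and \<open>j\<close> are adjacent iff \<open>c (i - j)\<close> has
  the entry \<open>circulant_symbol m c (i - j)\<close> at \<open>(i, j)\<close>.
\<close>

definition circulant_symbol :: "nat \<Rightarrow> (int \<Rightarrow> bool) \<Rightarrow> int \<Rightarrow> int" where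
  "circulant_symbol m c x =
     (if int m dvd x then int (card {d. d < m \<and> c (int d)}) else 0) - of_bool (c x)"

lemma reduced_laplacian_circulant:
  assumes per: "\<And>x. c (x + int (Suc N)) = c x" and even: "\<And>x. c (- x) = c x"
    and edge: "\<And>i j. i < Suc N \<Longrightarrow> j < Suc N \<Longrightarrow> {i, j} \<in> E \<longleftrightarrow> c (int i - int j)"
  shows "reduced_laplacian N E = mat N N (\<lambda>(i, j). circulant_symbol (Suc N) c (int i - int j))"
    (is "_ = ?L")
proof (rule eq_matI)
  fix i j assume "i < dim_row ?L" "j < dim_col ?L"
  then have ij: "i < N" "j < N" by auto
  have "{v \<in> {0..<Suc N}. {i, v} \<in> E} = {v. v < Suc N \<and> c (- int i + int v)}"
  proof (rule Collect_cong)
    fix v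
    show "v \<in> {0..<Suc N} \<and> {i, v} \<in> E \<longleftrightarrow> v < Suc N \<and> c (- int i + int v)"
      using edge[of i v] even[of "int i - int v"] ij by auto
  qed
  then have "int (card {v \<in> {0..<Suc N}. {i, v} \<in> E}) = (\<Sum>v<Suc N. of_bool (c (- int i + int v)))"
    unfolding sum_of_bool_card by simp
  also have "\<dots> = (\<Sum>v<Suc N. of_bool (c (int v)))"
    by (rule sum_period_shift) (simp only: per)
  finally have "int (card {v \<in> {0..<Suc N}. {i, v} \<in> E}) = int (card {d. d < Suc N \<and> c (int d)})"
    unfolding sum_of_bool_card .
  moreover have "int (Suc N) dvd int i - int j \<longleftrightarrow> i = j"
    by (rule int_diff_dvd_iff) (use ij in auto)
  moreover have "{i, j} \<in> E \<longleftrightarrow> c (int i - int j)" using edge[of i j] ij by simp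
  ultimately show "reduced_laplacian N E $$ (i, j) = ?L $$ (i, j)"
    using ij unfolding reduced_laplacian_def circulant_symbol_def
    by (simp only: index_mat split_conv)
qed (auto simp: reduced_laplacian_def)

text \<open>
  The alternating sum of the symbol \<open>l\<close> is its sum, which is zero, minus twice its sum over odd
  residues, where \<open>l\<close> is \<open>- 1\<close> at the jumps and \<open>0\<close> elsewhere. So it is twice the number of odd jumps.
\<close>

theorem spanning_trees_even_circulant:
  fixes c :: "int \<Rightarrow> bool"
  assumes "n > 0" and c_per: "\<And>x. c (x + int (2 * n)) = c x" and c_even: "\<And>x. c (- x) = c x"
    and "\<not> c 0"
  shows "\<exists>g. int (num_spanning_trees {0..<2 * n}
             {{i, j} | i j. i < 2 * n \<and> j < 2 * n \<and> c (int j - int i)}) =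
           int (card {d. d < 2 * n \<and> odd d \<and> c (int d)}) * int n * g\<^sup>2"
proof -
  obtain k where n: "n = Suc k" using \<open>n > 0\<close> by (cases n) auto
  define m where "m = 2 * Suc k"
  define E where "E = {{i, j} | i j. i < m \<and> j < m \<and> c (int j - int i)}"
  define l where "l = circulant_symbol m c"
  let ?N = "2 * k + 1"
  have m: "m = Suc ?N" "2 * n = m" by (simp_all add: m_def n)
  note per = c_per[unfolded m(2)]
  have edge: "{i, j} \<in> E \<longleftrightarrow> c (int i - int j)" if "i < m" "j < m" for i j
    using that c_even[of "int i - int j"] by (auto simp: E_def doubleton_eq_iff)
  have zero: "int m dvd int d \<longleftrightarrow> d = 0" if "d < m" for d
    using that int_diff_dvd_iff[of d m 0] by simp
  have l_per: "l (x + int m) = l x" for x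
    using per[of x] by (simp add: l_def circulant_symbol_def)
  have l_even: "l (- x) = l x" for x
    unfolding l_def circulant_symbol_def c_even by simp
  have l_sum: "(\<Sum>d<m. l (int d)) = 0"
  proof -
    have "(\<Sum>d<m. l (int d)) = (\<Sum>d<m. if d = 0 then int (card {d. d < m \<and> c (int d)}) else 0)
        - (\<Sum>d<m. of_bool (c (int d)))"
      unfolding sum_subtractf[symmetric]
    proof (rule sum.cong[OF refl])
      fix d assume "d \<in> {..<m}"
      then have "int m dvd int d \<longleftrightarrow> d = 0" by (intro zero) simp
      then show "l (int d) = (if d = 0 then int (card {d. d < m \<and> c (int d)}) else 0)
          - of_bool (c (int d))"
        unfolding l_def circulant_symbol_def by (simp only:)
    qed
    then show ?thesis unfolding sum_of_bool_card using m(1) by simp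
  qed
  have "e \<subseteq> {0..<Suc ?N} \<and> card e = 2" if e: "e \<in> E" for e
  proof -
    obtain i j where "e = {i, j}" "i < m" "j < m" "c (int j - int i)"
      using e unfolding E_def by blast
    moreover from this have "i \<noteq> j" using \<open>\<not> c 0\<close> by auto
    ultimately show ?thesis unfolding m(1) by simp
  qed
  then have "int (num_spanning_trees {0..<m} E) = det (reduced_laplacian ?N E)"
    unfolding m(1) by (rule matrix_tree[symmetric])
  also have "reduced_laplacian ?N E = mat ?N ?N (\<lambda>(i, j). l (int i - int j))"
    unfolding l_def by (rule reduced_laplacian_circulant[of c ?N E, folded m(1), OF per c_even edge])
  finally have main: "int m * int (num_spanning_trees {0..<m} E) =
      (\<Sum>d<m. l (int d) * (- 1) ^ d) * (det (odd_part_mat k l))\<^sup>2"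
    using det_reduced_even_circulant[of l k, folded m_def, OF l_per l_even l_sum] by (simp only:)
  obtain g where g: "det (odd_part_mat k l) = int (Suc k) * g"
    using dvd_det_odd_part[of l k, folded m_def, OF l_per l_even l_sum] by blast
  have "(\<Sum>d<m. l (int d) * (- 1) ^ d) = (\<Sum>d<m. l (int d)) + 2 * (\<Sum>d<m. of_bool (odd d \<and> c (int d)))"
    unfolding sum_distrib_left sum.distrib[symmetric]
  proof (rule sum.cong[OF refl])
    fix d assume "d \<in> {..<m}"
    then have "l (int d) = - of_bool (c (int d))" if "odd d"
      using zero[of d] that unfolding l_def circulant_symbol_def by auto
    then show "l (int d) * (- 1) ^ d = l (int d) + 2 * of_bool (odd d \<and> c (int d))"
      by (cases "odd d") auto
  qed
  also have "\<dots> = 2 * int (card {d. d < m \<and> odd d \<and> c (int d)})"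
    unfolding l_sum sum_of_bool_card by simp
  finally have "int m * int (num_spanning_trees {0..<m} E) =
      int m * (int (card {d. d < m \<and> odd d \<and> c (int d)}) * int n * g\<^sup>2)"
    using main unfolding g by (simp add: power2_eq_square m_def n)
  then have "int (num_spanning_trees {0..<m} E) =
      int (card {d. d < m \<and> odd d \<and> c (int d)}) * int n * g\<^sup>2"
    using m(1) by simp
  then show ?thesis unfolding E_def m(2) by blast
qed

section \<open>The jumps of the given graph\<close>

lemma cong_jump_iff:
  assumes d: "d < m" and t: "0 < t" "t < m"
  shows "[int d = int t] (mod int m) \<or> [int d = - int t] (mod int m) \<longleftrightarrow> d = t \<or> d = m - t"
proof -
  have "[int d = int t] (mod int m) \<longleftrightarrow> d = t"
    using int_diff_dvd_iff[OF d t(2)] by (simp add: cong_iff_dvd_diff)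
  moreover have "int d - - int t = (int d - int (m - t)) + int m" using t by (simp add: of_nat_diff)
  then have "[int d = - int t] (mod int m) \<longleftrightarrow> int m dvd int d - int (m - t)"
    unfolding cong_iff_dvd_diff by (simp only: dvd_add_triv_right_iff)
  then have "[int d = - int t] (mod int m) \<longleftrightarrow> d = m - t"
    using int_diff_dvd_iff[OF d, of "m - t"] t by simp
  ultimately show ?thesis by simp
qed

text \<open>
  The residues \<open>s i\<close> and \<open>2 n - s i\<close> have the same parity and lie on different sides of \<open>n\<close>, so
  each odd \<open>s i\<close> counts twice, while \<open>n\<close>, its own negative, counts at most once.
\<close>

lemma card_odd_jumps:
  fixes s :: "'a \<Rightarrow> nat"
  assumes "finite I" and s: "\<And>i. i \<in> I \<Longrightarrow> 0 < s i \<and> s i < n" and inj: "inj_on s I"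
    and c: "\<And>d. d < 2 * n \<Longrightarrow> c d \<longleftrightarrow> (\<exists>t\<in>s ` I \<union> {n}. d = t \<or> d = 2 * n - t)"
    and "n > 0"
  shows "card {d. d < 2 * n \<and> odd d \<and> c d} = 2 * card {i \<in> I. odd (s i)} + of_bool (odd n)"
proof -
  let ?J = "{i \<in> I. odd (s i)}"
  let ?H = "if odd n then {n} else {}"
  have "{d. d < 2 * n \<and> odd d \<and> c d} = s ` ?J \<union> (\<lambda>i. 2 * n - s i) ` ?J \<union> ?H" (is "?L = ?R")
  proof (rule Set.set_eqI)
    fix d
    have bound: "s i < 2 * n" "\<not> 2 * n < s i" "2 * n - s i < 2 * n" if "i \<in> I" for i
      using s[OF that] by auto
    have "d \<in> ?L \<longleftrightarrow> d < 2 * n \<and> odd d \<and> ((\<exists>i\<in>I. d = s i \<or> d = 2 * n - s i) \<or> d = n)"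
      using c[of d] by auto
    also have "\<dots> \<longleftrightarrow> d \<in> ?R" using bound \<open>n > 0\<close> by (auto split: if_splits)
    finally show "d \<in> ?L \<longleftrightarrow> d \<in> ?R" .
  qed
  moreover have "card ?R = card (s ` ?J) + card ((\<lambda>i. 2 * n - s i) ` ?J) + card ?H"
  proof -
    have "s i \<noteq> 2 * n - s j" "s i \<noteq> n" "n \<noteq> 2 * n - s i" if "i \<in> I" "j \<in> I" for i j
      using s[OF that(1)] s[OF that(2)] by linarith+
    then have "s ` ?J \<inter> (\<lambda>i. 2 * n - s i) ` ?J = {}"
      "(s ` ?J \<union> (\<lambda>i. 2 * n - s i) ` ?J) \<inter> ?H = {}"
      by auto
    moreover have "finite (s ` ?J)" "finite ((\<lambda>i. 2 * n - s i) ` ?J)" "finite ?H"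
      using \<open>finite I\<close> by auto
    ultimately show ?thesis by (simp only: card_Un_disjoint finite_Un simp_thms)
  qed
  moreover have "card (s ` ?J) = card ?J"
    using inj by (intro card_image) (auto simp: inj_on_def)
  moreover have "card ((\<lambda>i. 2 * n - s i) ` ?J) = card ?J"
  proof (rule card_image, rule inj_onI)
    fix x y assume xy: "x \<in> ?J" "y \<in> ?J" "2 * n - s x = 2 * n - s y"
    then have "s x = s y" using s[of x] s[of y] by auto
    then show "x = y" using xy inj by (auto dest: inj_onD)
  qed
  ultimately show ?thesis by simp
qed

theorem theorem4:
  fixes k :: nat and s :: "nat \<Rightarrow> nat" and p q r :: nat
    and V :: "nat \<Rightarrow> nat set" and E :: "nat \<Rightarrow> nat set set" and \<tau> :: "nat \<Rightarrow> nat"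
  assumes k_pos: "k \<ge> 1"
    and s_pos: "s 1 \<ge> 1"
    and s_mono: "strict_mono_on {1..k} s"
    and V_eq: "\<And>n. V n = {0..<2 * n}"
    and E_eq: "\<And>n. E n = circulant_edges (2 * n) (s ` {1..k} \<union> {n})"
    and tau_eq: "\<And>n. \<tau> n = num_spanning_trees (V n) (E n)"
    and p_eq: "p = card {i \<in> {1..k}. odd (s i)}"
    and q_eq: "q = squarefree_part (2 * p)"
    and r_eq: "r = squarefree_part (2 * p + 1)"
  shows "\<exists>a :: nat \<Rightarrow> int. \<forall>n. n > s k \<and> graph_connected (V n) (E n) \<longrightarrow>
           (odd n \<longrightarrow> int (\<tau> n) = int r * int n * (a n)\<^sup>2) \<and>
           (even n \<longrightarrow> int (\<tau> n) = int q * int n * (a n)\<^sup>2)"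
proof -
  have "\<exists>a::int. (odd n \<longrightarrow> int (\<tau> n) = int r * int n * a\<^sup>2) \<and>
      (even n \<longrightarrow> int (\<tau> n) = int q * int n * a\<^sup>2)" if n: "n > s k" for n
  proof -
    let ?S = "s ` {1..k} \<union> {n}"
    have "n > 0" using n by simp
    have s: "0 < s i \<and> s i < n" if "i \<in> {1..k}" for i
    proof -
      have "s 1 \<le> s i" "s i \<le> s k"
        using strict_mono_on_leD[OF s_mono] that by auto
      then show ?thesis using s_pos n by simp
    qed
    define c where
      "c x \<longleftrightarrow> (\<exists>t\<in>?S. [x = int t] (mod int (2 * n)) \<or> [x = - int t] (mod int (2 * n)))" for x
    have jumps: "c (int d) \<longleftrightarrow> (\<exists>t\<in>?S. d = t \<or> d = 2 * n - t)" if "d < 2 * n" for d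
      unfolding c_def using s \<open>n > 0\<close>
      by (intro bex_cong refl cong_jump_iff that) fastforce+
    have c_per: "c (x + int (2 * n)) = c x" for x
      unfolding c_def by (simp add: cong_def)
    have c_even: "c (- x) = c x" for x
    proof -
      have "[- x = y] (mod int (2 * n)) \<longleftrightarrow> [x = - y] (mod int (2 * n))" for y
        using cong_minus_minus_iff[of x "- y"] by simp
      then show ?thesis unfolding c_def by auto
    qed
    have "\<not> c 0" using jumps[of 0] s \<open>n > 0\<close> by fastforce
    have edges: "E n = {{i, j} | i j. i < 2 * n \<and> j < 2 * n \<and> c (int j - int i)}"
    proof -
      have "[int j = int i + y] (mod int (2 * n)) \<longleftrightarrow> [int j - int i = y] (mod int (2 * n))"
        for i j y by (simp add: cong_iff_dvd_diff algebra_simps)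
      note this[of _ _ "int _"] this[of _ _ "- int _"]
      then have "c (int j - int i) \<longleftrightarrow> (\<exists>t\<in>?S. [int j = int i + int t] (mod int (2 * n)) \<or>
          [int j = int i - int t] (mod int (2 * n)))" for i j
        unfolding c_def by simp
      then show ?thesis unfolding E_eq circulant_edges_def by simp
    qed
    have inj: "inj_on s {1..k}" using s_mono by (rule strict_mono_on_imp_inj_on)
    have odd_jumps: "card {d. d < 2 * n \<and> odd d \<and> c (int d)} = 2 * p + of_bool (odd n)"
      unfolding p_eq using s inj jumps \<open>n > 0\<close> by (intro card_odd_jumps) auto
    obtain g where g: "int (\<tau> n) = int (2 * p + of_bool (odd n)) * int n * g\<^sup>2"
      using spanning_trees_even_circulant[of n c, OF \<open>n > 0\<close> c_per c_even \<open>\<not> c 0\<close>]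
      unfolding tau_eq V_eq edges odd_jumps by blast
    define f where "f = 2 * p + of_bool (odd n)"
    have "int f = int (squarefree_part f) * (int (square_part f))\<^sup>2"
      using arg_cong[OF squarefree_decompose[of f], of int] by simp
    then have "int (\<tau> n) = int (squarefree_part f) * int n * (int (square_part f) * g)\<^sup>2"
      using g unfolding f_def[symmetric] by (simp add: power_mult_distrib)
    moreover have "squarefree_part f = (if odd n then r else q)"
      by (simp add: f_def r_eq q_eq)
    ultimately show ?thesis by auto
  qed
  then show ?thesis by metis
qed

end
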